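(* Let $m\ge 4$ be an integer. Then there exist infinitely many pairs of positive integers $(N,d)$ such that each of $N,N+d,\ldots,N+(m-1)d$ is squarefull and $$d\ll N^{\frac{2m-4}{2m-3}}(\log N)^{\frac{-2}{2m-3}},$$ where the implied constant depends only on $m$.
   Context: A positive integer is squarefull if every prime dividing it divides it at least to the second power. *)

theory Defs
  imports Complex_Main "HOL-Computational_Algebra.Primes"
begin

definition squarefull :: "nat \<Rightarrow> bool" where
  "squarefull n \<longleftrightarrow> n > 0 \<and> (\<forall>p. prime p \<longrightarrow> p dvd n \<longrightarrow> p ^ 2 dvd n)"

end

theory Submission imports Defs begin

text \<open>
  If \<open>n + 1\<close> is a square and \<open>n + 2\<close> is twice a square, then multiplying
  \<open>n, n + 1, \<dots>, n + m - 1\<close> by \<open>B\<^sup>2\<close> yields squarefull numbers as soon as \<open>B\<close> contains \<open>2\<close> and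
  every prime of the remaining \<open>m - 2\<close> terms. This gives \<open>d = B\<^sup>2\<close> and \<open>N = n B\<^sup>2\<close> with \<open>B\<close> of
  order \<open>n\<^bsup>m-2\<^esup>\<close>. The logarithm is gained by making \<open>n\<close> divisible by a power \<open>2\<^bsup>k\<^esup>\<close> of order
  \<open>log n\<close>, which may be dropped from \<open>B\<close>: write \<open>a + b\<surd>2 = (3 + 2\<surd>2)\<^bsup>2^k\<^esup>\<close>
  and multiply by \<open>1 + \<surd>2\<close> to get a solution \<open>(a + 2b, a + b)\<close> of \<open>x\<^sup>2 + 1 = 2y\<^sup>2\<close>; each
  squaring adds a factor \<open>2\<close> to \<open>b\<close>, and \<open>b\<close> divides \<open>n = x\<^sup>2 - 1\<close>.
\<close>

text \<open>Squaring \<open>a + b * sqrt 2\<close> replaces \<open>(a, b)\<close> by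
  \<open>(a\<^sup>2 + 2 * b\<^sup>2, 2 * a * b)\<close> and preserves norm 1. The bound is put on
  \<open>2 * a\<close> because \<open>2 * b\<^sup>2 < a\<^sup>2\<close> makes the doubled first
  component at most \<open>(2 * a)\<^sup>2\<close>, so the bound squares along with the
  solution.\<close>

lemma pell_solution_divisible_by_power_of_2:
  "\<exists>a b::nat. a\<^sup>2 = 2 * b\<^sup>2 + 1 \<and> 2 ^ k dvd b \<and> b > 0 \<and> 2 * a \<le> 6 ^ 2 ^ k"
proof (induction k)
  case 0
  show ?case by (intro exI[of _ 3] exI[of _ 2]) auto
next
  case (Suc k)
  then obtain a b :: nat where ab: "a\<^sup>2 = 2 * b\<^sup>2 + 1" "2 ^ k dvd b" "b > 0" "2 * a \<le> 6 ^ 2 ^ k"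
    by blast
  have "(a\<^sup>2 + 2 * b\<^sup>2)\<^sup>2 = 2 * (2 * a * b)\<^sup>2 + 1"
    by (simp only: power_mult_distrib ab(1)) (simp add: power2_eq_square algebra_simps)
  moreover have "2 ^ Suc k dvd 2 * a * b"
    using mult_dvd_mono[OF dvd_refl[of 2] dvd_mult[OF ab(2), of a]] by (simp add: mult.assoc)
  moreover have "a > 0"
    using ab(1) by (intro Nat.gr0I) auto
  moreover have "2 * (a\<^sup>2 + 2 * b\<^sup>2) \<le> (2 * a)\<^sup>2"
    using ab(1) by (simp add: power_mult_distrib)
  moreover have "(2 * a)\<^sup>2 \<le> (6 ^ 2 ^ k)\<^sup>2"
    by (rule power_mono[OF ab(4)]) simp
  moreover have "(6 ^ 2 ^ k)\<^sup>2 = (6::nat) ^ 2 ^ Suc k"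
    by (simp only: power_mult[symmetric] power_Suc mult.commute)
  ultimately show ?case
    using \<open>b > 0\<close> by (intro exI[of _ "a\<^sup>2 + 2 * b\<^sup>2"] exI[of _ "2 * a * b"]) auto
qed

text \<open>The upper bound is what makes \<open>2 ^ k\<close> at least of order \<open>ln n\<close>
  for \<open>n = 2 ^ k * r\<close>; without it the power of 2 could be too small to pay for the
  logarithm.\<close>

lemma multiple_of_power_of_2_before_square_and_double_square:
  "\<exists>r x y::nat. r > 0 \<and> 2 ^ k * r + 1 = x\<^sup>2 \<and> 2 ^ k * r + 2 = 2 * y\<^sup>2 \<and>
     2 ^ k * r \<le> 6 ^ (3 * 2 ^ k)"
proof -
  obtain a b :: nat where ab: "a\<^sup>2 = 2 * b\<^sup>2 + 1" "2 ^ k dvd b" "b > 0" "2 * a \<le> 6 ^ 2 ^ k"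
    using pell_solution_divisible_by_power_of_2 by blast
  obtain c where c: "b = 2 ^ k * c"
    using ab(2) by blast
  \<comment> \<open>From \<open>(a + 2 * b)\<^sup>2 - 1 = 6 * b\<^sup>2 + 4 * a * b = 2 * b * (3 * b
    + 2 * a)\<close>, with \<open>2 ^ k\<close> taken out of \<open>b\<close>.\<close>
  define r where "r = 2 * c * (3 * b + 2 * a)"
  have n: "2 ^ k * r = 6 * b\<^sup>2 + 4 * (a * b)"
    unfolding r_def c by (simp add: power2_eq_square algebra_simps)
  have "r > 0"
    using ab(3) c by (simp add: r_def)
  moreover have "2 ^ k * r + 1 = (a + 2 * b)\<^sup>2"
    using ab(1) unfolding n by (simp add: power2_eq_square algebra_simps)
  moreover have "2 ^ k * r + 2 = 2 * (a + b)\<^sup>2"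
    using ab(1) unfolding n by (simp add: power2_eq_square algebra_simps)
  moreover have "2 ^ k * r \<le> 6 ^ (3 * 2 ^ k)"
  proof -
    have "b\<^sup>2 \<le> a\<^sup>2"
      using ab(1) by simp
    then have "b \<le> a"
      by (simp add: power2_nat_le_eq_le)
    then have "a * b \<le> a\<^sup>2"
      by (simp add: power2_eq_square)
    with \<open>b\<^sup>2 \<le> a\<^sup>2\<close> have "2 ^ k * r \<le> 6 * (4 * a\<^sup>2)"
      unfolding n by linarith
    also have "\<dots> = 6 * (2 * a)\<^sup>2"
      by (simp add: power_mult_distrib)
    \<comment> \<open>The factor 6 is absorbed into a third copy of
      \<open>6 ^ 2 ^ k\<close>.\<close>
    also have "\<dots> \<le> 6 ^ 2 ^ k * (6 ^ 2 ^ k)\<^sup>2"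
      using ab(4) by (intro mult_mono power_mono self_le_power) auto
    also have "\<dots> = 6 ^ (3 * 2 ^ k)"
      by (simp add: power_mult[symmetric] power_add[symmetric])
    finally show ?thesis .
  qed
  ultimately show ?thesis by blast
qed

text \<open>Only primes \<open>p\<close> not dividing \<open>B\<close> need an argument. Such a
  \<open>p\<close> is odd, does not divide \<open>r\<close>, and divides \<open>n + i\<close>. This
  rules out \<open>i = 0\<close> and \<open>i \<ge> 3\<close>; for \<open>i = 1\<close> and
  \<open>i = 2\<close> the square in \<open>n + i\<close> supplies \<open>p\<^sup>2\<close>.\<close>

lemma squarefull_scaled_window:
  fixes r x y k m i :: nat
  defines "n \<equiv> 2 ^ k * r"
  defines "B \<equiv> 2 * r * (\<Prod>i=3..<m. n + i)"
  assumes "r > 0" and x: "n + 1 = x\<^sup>2" and y: "n + 2 = 2 * y\<^sup>2" and i: "i < m"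
  shows "squarefull (n * B\<^sup>2 + i * B\<^sup>2)"
  unfolding squarefull_def
proof (intro conjI allI impI)
  have "n > 0" "B > 0"
    using \<open>r > 0\<close> by (auto simp: n_def B_def intro!: prod_pos)
  then show "n * B\<^sup>2 + i * B\<^sup>2 > 0"
    by simp
  fix p :: nat
  assume p: "prime p" "p dvd n * B\<^sup>2 + i * B\<^sup>2"
  have eq: "n * B\<^sup>2 + i * B\<^sup>2 = (n + i) * B\<^sup>2"
    by (simp add: algebra_simps)
  show "p\<^sup>2 dvd n * B\<^sup>2 + i * B\<^sup>2"
  proof (cases "p dvd B")
    case True
    then show ?thesis
      unfolding eq by (simp add: dvd_power_same)
  next
    case False
    then have ni: "p dvd n + i"
      using p prime_dvd_power[OF p(1), of B 2] unfolding eq by (auto simp: prime_dvd_mult_iff)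
    have p2: "\<not> p dvd 2" and pr: "\<not> p dvd r"
      using False by (auto simp: B_def)
    consider "i = 0" | "i = 1" | "i = 2" | "i \<ge> 3"
      by linarith
    then have "p\<^sup>2 dvd n + i"
    proof cases
      case 1
      with ni p2 pr p(1) show ?thesis
        by (auto simp: n_def prime_dvd_mult_iff dest: prime_dvd_power)
    next
      case 2
      with ni x have "p dvd x"
        using prime_dvd_power[OF p(1)] by metis
      with 2 x show ?thesis
        by (metis dvd_power_same)
    next
      case 3
      with ni y p2 have "p dvd y"
        using prime_dvd_power[OF p(1)] prime_dvd_mult_iff[OF p(1)] by metis
      with 3 y show ?thesis
        by (metis dvd_power_same dvd_mult)
    next
      case 4
      with i have "n + i dvd (\<Prod>i=3..<m. n + i)"
        by (intro dvd_prodI) auto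
      with ni have "p dvd B"
        unfolding B_def by (metis dvd_trans dvd_mult)
      with False show ?thesis by blast
    qed
    then show ?thesis
      unfolding eq by simp
  qed
qed

text \<open>Two estimates are multiplied and \<open>2 ^ k\<close> cancels: \<open>2 ^ k * B\<close>
  is at most \<open>P * n ^ (m - 2)\<close>, and \<open>ln (n * B\<^sup>2)\<close> is at most a
  constant times \<open>2 ^ k\<close>.\<close>

lemma window_multiplier_bounds:
  fixes n k m r :: nat and B P :: real
  assumes "m \<ge> 4" "r > 0" and n: "n = 2 ^ k * r" and le: "n \<le> 6 ^ (3 * 2 ^ k)"
  defines "B \<equiv> real (2 * r * (\<Prod>i=3..<m. n + i))" and "P \<equiv> 2 * real m ^ m"
  shows "B * ln (real n * B\<^sup>2) \<le> P * (2 * P + 30 * real m) * real n ^ (m - 2)"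
proof -
  have n1: "n \<ge> 1"
    using \<open>r > 0\<close> by (simp add: n)
  have "(\<Prod>i=3..<m. n + i) \<ge> 1"
    using n1 by (intro prod_ge_1) auto
  then have "2 * r * (\<Prod>i=3..<m. n + i) \<ge> 1 * 1"
    using \<open>r > 0\<close> by (intro mult_mono) auto
  then have B1: "B \<ge> 1"
    unfolding B_def by linarith
  have P1: "P \<ge> 1"
    using \<open>m \<ge> 4\<close> one_le_power[of "real m" m] unfolding P_def by linarith
  have "n + i \<le> m * n" if "i < m" for i
  proof -
    have "n + i \<le> n + (m - 1) * n"
      using that n1 mult_le_mono[of i "m - 1" 1 n] by simp
    then show ?thesis
      using that by (simp add: diff_mult_distrib)
  qed
  then have "(\<Prod>i=3..<m. n + i) \<le> (\<Prod>i=3..<m. m * n)"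
    by (intro prod_mono) auto
  also have "\<dots> = m ^ (m - 3) * n ^ (m - 3)"
    by (simp add: power_mult_distrib)
  also have "\<dots> \<le> m ^ m * n ^ (m - 3)"
    using \<open>m \<ge> 4\<close> by (intro mult_right_mono power_increasing) auto
  \<comment> \<open>Multiplying by \<open>2 ^ k\<close> completes \<open>r\<close> to
    \<open>n\<close>, which raises the exponent from \<open>m - 3\<close> to
    \<open>m - 2\<close>.\<close>
  finally have "2 ^ k * (2 * r * (\<Prod>i=3..<m. n + i)) \<le> 2 ^ k * (2 * r * (m ^ m * n ^ (m - 3)))"
    by simp
  also have "\<dots> = 2 * m ^ m * (n * n ^ (m - 3))"
    by (simp add: n)
  also have "n * n ^ (m - 3) = n ^ (m - 2)"
    using \<open>m \<ge> 4\<close> power_Suc[of n "m - 3"] by (simp del: power_Suc add: Suc_diff_le[symmetric])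
  finally have "real (2 ^ k * (2 * r * (\<Prod>i=3..<m. n + i))) \<le> real (2 * m ^ m * n ^ (m - 2))"
    by (simp only: of_nat_le_iff)
  then have kB: "2 ^ k * B \<le> P * n ^ (m - 2)"
    by (simp add: B_def P_def)
  have "1 * B \<le> 2 ^ k * B"
    using B1 by (intro mult_right_mono) auto
  with kB have "B \<le> P * n ^ (m - 2)"
    by simp
  with B1 have "ln B \<le> ln (P * n ^ (m - 2))"
    by simp
  also have "\<dots> = ln P + (m - 2) * ln n"
    using n1 P1 by (simp add: ln_mult ln_realpow)
  also have "ln P \<le> P"
    using ln_le_minus_one[of P] P1 by simp
  finally have lnB: "ln B \<le> P + (m - 2) * ln n"
    by simp
  have "real n \<le> 6 ^ (3 * 2 ^ k)"
    using le by (metis of_nat_le_iff of_nat_numeral of_nat_power)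
  then have "ln (real n) \<le> ln (6 ^ (3 * 2 ^ k))"
    using n1 by (subst ln_le_cancel_iff) auto
  also have "\<dots> = (3 * 2 ^ k) * ln 6"
    by (simp add: ln_realpow)
  \<comment> \<open>The 5 comes from \<open>ln x \<le> x - 1\<close> at
    \<open>x = 6\<close>.\<close>
  also have "\<dots> \<le> (3 * 2 ^ k) * 5"
    using ln_le_minus_one[of 6] by (intro mult_left_mono) auto
  finally have lnn: "ln n \<le> 15 * 2 ^ k"
    by simp
  have "ln (n * B\<^sup>2) = ln n + 2 * ln B"
    using n1 B1 by (simp add: ln_mult ln_realpow)
  also have "\<dots> \<le> 2 * P + (1 + 2 * real (m - 2)) * ln n"
    using lnB by (simp add: algebra_simps)
  also have "\<dots> \<le> 2 * P * 2 ^ k + (2 * real m) * (15 * 2 ^ k)"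
  proof (rule add_mono)
    show "2 * P \<le> 2 * P * 2 ^ k"
      using P1 mult_left_mono[of 1 "2 ^ k" "2 * P"] by simp
    show "(1 + 2 * real (m - 2)) * ln n \<le> (2 * real m) * (15 * 2 ^ k)"
      using \<open>m \<ge> 4\<close> n1 by (intro mult_mono lnn) auto
  qed
  also have "\<dots> = 2 ^ k * (2 * P + 30 * real m)"
    by (simp add: algebra_simps)
  finally have "B * ln (n * B\<^sup>2) \<le> B * (2 ^ k * (2 * P + 30 * real m))"
    using B1 by (intro mult_left_mono) auto
  also have "\<dots> = (2 ^ k * B) * (2 * P + 30 * real m)"
    by simp
  also have "\<dots> \<le> (P * n ^ (m - 2)) * (2 * P + 30 * real m)"
    using kB P1 by (intro mult_right_mono) auto
  finally show ?thesis
    by (simp add: mult_ac)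
qed

text \<open>The hypothesis is solved for \<open>B\<^sup>2\<close> in terms of
  \<open>N = n * B\<^sup>2\<close>. With \<open>q = 2 * m - 3\<close> one has
  \<open>m - 2 = (q - 1) / 2\<close>, so raising to the power \<open>2 / q\<close> gives
  \<open>n\<close> the desired exponent \<open>(q - 1) / q\<close>.\<close>

lemma square_le_powr_of_log_bound:
  fixes n B K :: real and m :: nat
  assumes "m \<ge> 4" "n > 1" "B \<ge> 1" "K > 0"
    and le: "B * ln (n * B\<^sup>2) \<le> K * n ^ (m - 2)"
  shows "B\<^sup>2 \<le> K powr (2 / (2 * real m - 3)) *
      (n * B\<^sup>2) powr ((2 * real m - 4) / (2 * real m - 3)) *
      ln (n * B\<^sup>2) powr (- 2 / (2 * real m - 3))"
proof -
  define q where "q = 2 * real m - 3"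
  define L where "L = ln (n * B\<^sup>2)"
  have q: "q > 0"
    using \<open>m \<ge> 4\<close> by (simp add: q_def)
  have "1 * 1 < n * B\<^sup>2"
    using assms by (intro mult_less_le_imp_less) auto
  then have L: "L > 0"
    by (simp add: L_def)
  have e: "(2 * real m - 4) / (2 * real m - 3) = (q - 1) / q"
    by (simp add: q_def)
  have m2: "real (m - 2) = (q - 1) / 2"
    using \<open>m \<ge> 4\<close> by (simp add: q_def of_nat_diff field_simps)
  have "n ^ (m - 2) = n powr ((q - 1) / 2)"
    using \<open>n > 1\<close> powr_realpow[of n "m - 2"] unfolding m2 by simp
  with le have "B * L \<le> K * n powr ((q - 1) / 2)"
    unfolding L_def by simp
  then have "(B * L) powr (2 / q) \<le> (K * n powr ((q - 1) / 2)) powr (2 / q)"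
    using L q \<open>B \<ge> 1\<close> by (intro powr_mono2) auto
  also have "\<dots> = K powr (2 / q) * n powr ((q - 1) / q)"
    using assms q by (simp add: powr_mult powr_powr diff_divide_distrib)
  finally have "B powr (2 / q) * L powr (2 / q) \<le> K powr (2 / q) * n powr ((q - 1) / q)"
    using assms L by (simp add: powr_mult)
  then have "B powr (2 / q) \<le> K powr (2 / q) * n powr ((q - 1) / q) * L powr (- 2 / q)"
    using L by (simp add: powr_minus field_simps)
  \<comment> \<open>This factor completes \<open>n\<close> to \<open>n * B\<^sup>2\<close> on the
    right and brings the exponent of \<open>B\<close> on the left to 2.\<close>
  then have "B powr (2 / q) * B powr (2 * ((q - 1) / q)) \<le>
      K powr (2 / q) * n powr ((q - 1) / q) * L powr (- 2 / q) * B powr (2 * ((q - 1) / q))"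
    by (intro mult_right_mono) auto
  also have "B powr (2 / q) * B powr (2 * ((q - 1) / q)) = B powr 2"
    using q by (simp flip: powr_add add: field_simps)
  also have "B powr (2 * ((q - 1) / q)) = (B\<^sup>2) powr ((q - 1) / q)"
    using \<open>B \<ge> 1\<close> powr_powr[of B 2 "(q - 1) / q"] by (simp add: powr_numeral)
  finally show ?thesis
    using assms unfolding e by (simp add: powr_mult L_def q_def mult_ac)
qed

theorem theorem3:
  fixes m :: nat
  assumes "m \<ge> 4"
  shows "\<exists>C::real. C > 0 \<and>
    infinite {(N :: nat, d :: nat). N > 0 \<and> d > 0 \<and>
      (\<forall>i<m. squarefull (N + i * d)) \<and>
      real d \<le> C * real N powr ((2 * real m - 4) / (2 * real m - 3))
                 * ln (real N) powr (- 2 / (2 * real m - 3))}"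
proof -
  define P where "P = 2 * real m ^ m"
  define K where "K = P * (2 * P + 30 * real m)"
  define C where "C = K powr (2 / (2 * real m - 3))"
  define S where "S = {(N :: nat, d :: nat). N > 0 \<and> d > 0 \<and>
      (\<forall>i<m. squarefull (N + i * d)) \<and>
      real d \<le> C * real N powr ((2 * real m - 4) / (2 * real m - 3))
                 * ln (real N) powr (- 2 / (2 * real m - 3))}"
  have "K > 0"
    using assms by (simp add: K_def P_def add_pos_pos)
  then have "C > 0"
    by (simp add: C_def)
  \<comment> \<open>Infinitude follows from unbounded first components. Taking
    \<open>k \<ge> 1\<close> gives \<open>n > k \<ge> 1\<close>, which keeps the logarithm of
    \<open>N\<close> positive.\<close>
  have "\<exists>N d. (N, d) \<in> S \<and> k < N" if "k \<ge> 1" for k :: nat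
  proof -
    obtain r x y :: nat where r: "r > 0" "2 ^ k * r + 1 = x\<^sup>2" "2 ^ k * r + 2 = 2 * y\<^sup>2"
        "2 ^ k * r \<le> 6 ^ (3 * 2 ^ k)"
      using multiple_of_power_of_2_before_square_and_double_square by blast
    define n where "n = 2 ^ k * r"
    define B where "B = 2 * r * (\<Prod>i=3..<m. n + i)"
    have "k < 2 ^ k"
      by simp
    also have "2 ^ k \<le> n"
      using r(1) by (simp add: n_def)
    finally have "k < n" .
    have "B > 0"
      using r(1) \<open>k < n\<close> by (auto simp: B_def intro!: prod_pos)
    have "real B * ln (real n * (real B)\<^sup>2) \<le> K * real n ^ (m - 2)"
      unfolding B_def K_def P_def
      using window_multiplier_bounds[OF assms r(1) n_def] r(4) by (simp add: n_def)
    then have "(real B)\<^sup>2 \<le> C * (real n * (real B)\<^sup>2) powr ((2 * real m - 4) / (2 * real m - 3))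
        * ln (real n * (real B)\<^sup>2) powr (- 2 / (2 * real m - 3))"
      unfolding C_def using \<open>B > 0\<close> \<open>k < n\<close> \<open>k \<ge> 1\<close> \<open>K > 0\<close> assms
      by (intro square_le_powr_of_log_bound) auto
    moreover have "\<forall>i<m. squarefull (n * B\<^sup>2 + i * B\<^sup>2)"
      using squarefull_scaled_window[OF r(1-3)] by (simp add: n_def B_def)
    ultimately have "(n * B\<^sup>2, B\<^sup>2) \<in> S"
      using \<open>B > 0\<close> \<open>k < n\<close> by (simp add: S_def)
    moreover have "n * 1 \<le> n * B\<^sup>2"
      using \<open>B > 0\<close> by (intro mult_le_mono2) (simp add: Suc_le_eq)
    ultimately show ?thesis
      using \<open>k < n\<close> by (metis le_trans not_le mult_1_right)
  qed
  then have large: "\<exists>N \<in> fst ` S. k < N" if "k \<ge> 1" for k :: nat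
    using that by force
  have "infinite (fst ` S)"
  proof
    assume "finite (fst ` S)"
    then obtain k where "\<forall>N \<in> fst ` S. N \<le> k"
      unfolding finite_nat_set_iff_bounded_le by blast
    \<comment> \<open>\<open>Suc k\<close> meets the condition \<open>k \<ge> 1\<close> of
      \<open>large\<close> even if the bound is 0.\<close>
    with large[of "Suc k"] show False
      by fastforce
  qed
  then have "infinite S"
    using finite_imageI by blast
  with \<open>C > 0\<close> show ?thesis
    unfolding S_def by blast
qed

end
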